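(* Let $\mathcal{A}\in\mathbb{C}^{n_1\times n_2\times n_3}$ and let $\mathcal{A}=\mathcal{U}*_c\mathcal{S}*_c\mathcal{V}^H$ be the C-SVD of $\mathcal{A}$. Then $$\mathcal{A}^\dagger=\mathcal{V}*_c\mathcal{S}^\dagger*_c\mathcal{U}^H.$$
   Context: For a third-order tensor $\mathcal{A}\in\mathbb{C}^{n_1\times n_2\times n_3}$, $\mathcal{A}^{(i)}=\mathcal{A}(:,:,i)\in\mathbb{C}^{n_1\times n_2}$ denotes its $i$-th frontal slice. Let $\mathbf{C}_{n_3}$ be the $n_3\times n_3$ orthogonal DCT matrix, with entries $(\mathbf{C}_{n_3})_{jk}=\sqrt{(2-\delta_{j1})/n_3}\,\cos\big(\tfrac{(j-1)(2k-1)\pi}{2n_3}\big)$; let $\mathbf{W}$ be the diagonal matrix whose diagonal is the first column of $\mathbf{C}_{n_3}$; let $\mathbf{Z}$ be the $n_3\times n_3$ matrix with ones on the first superdiagonal and zeros elsewhere; and put $\mathbf{M}=\mathbf{W}^{-1}\mathbf{C}_{n_3}(\mathbf{I}+\mathbf{Z})$, an invertible matrix. Define the linear bijection $L$ on tensors with third dimension $n_3$ by $L(\mathcal{A})_{ijk}=\sum_{l=1}^{n_3}\mathbf{M}_{kl}\mathcal{A}_{ijl}$. The C-product of $\mathcal{A}\in\mathbb{C}^{n_1\times n_2\times n_3}$ and $\mathcal{B}\in\mathbb{C}^{n_2\times l\times n_3}$ is the tensor $\mathcal{A}*_c\mathcal{B}\in\mathbb{C}^{n_1\times l\times n_3}$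 determined by $L(\mathcal{A}*_c\mathcal{B})^{(i)}=L(\mathcal{A})^{(i)}L(\mathcal{B})^{(i)}$, $i=1,\dots,n_3$. The conjugate transpose $\mathcal{A}^H$ is determined by $L(\mathcal{A}^H)^{(i)}=(L(\mathcal{A})^{(i)})^H$ for all $i$. The identity tensor $\mathcal{I}\in\mathbb{C}^{n\times n\times n_3}$ is determined by $L(\mathcal{I})^{(i)}=\mathbf{I}_n$ for all $i$. A tensor $\mathcal{Q}\in\mathbb{C}^{n\times n\times n_3}$ is unitary if $\mathcal{Q}^H*_c\mathcal{Q}=\mathcal{Q}*_c\mathcal{Q}^H=\mathcal{I}$. A tensor is F-diagonal if all its frontal slices are diagonal matrices. A C-SVD of $\mathcal{A}\in\mathbb{C}^{n_1\times n_2\times n_3}$ is a factorization $\mathcal{A}=\mathcal{U}*_c\mathcal{S}*_c\mathcal{V}^H$ with $\mathcal{U}\in\mathbb{C}^{n_1\times n_1\times n_3}$, $\mathcal{V}\in\mathbb{C}^{n_2\times n_2\times n_3}$ unitary and $\mathcal{S}\in\mathbb{C}^{n_1\times n_2\times n_3}$ F-diagonal. The Moore-Penrose inverse $\mathcal{A}^\dagger$ is the (unique) tensor $\mathcal{X}\in\mathbb{C}^{n_2\times n_1\times n_3}$ with $\mathcal{A}*_c\mathcal{X}*_c\mathcal{A}=\mathcal{A}$, $\mathcal{X}*_c\mathcal{A}*_c\mathcal{X}=\mathcal{X}$, $(\mathcal{A}*_c\mathcal{X})^H=\mathcal{A}*_c\mathcal{X}$, $(\mathcal{X}*_c\mathcal{A})^H=\mathcal{X}*_c\mathcal{A}$.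 *)

theory Defs
  imports
    "Jordan_Normal_Form.Schur_Decomposition"
    "Jordan_Normal_Form.Gauss_Jordan_Elimination"
begin

text \<open>A third-order tensor is represented by the list of its frontal slices, so that the entry
  with (0-based) indices \<open>i\<close>, \<open>j\<close>, \<open>k\<close> is \<open>(A ! k) $$ (i, j)\<close>. All indices start at 0.\<close>

type_synonym tensor = "complex mat list"

definition carrier_tensor :: "nat \<Rightarrow> nat \<Rightarrow> nat \<Rightarrow> tensor set" where
  "carrier_tensor n1 n2 n3 = {A. length A = n3 \<and> (\<forall>i<n3. A ! i \<in> carrier_mat n1 n2)}"

text \<open>The first two dimensions are read off the first slice; they are only meaningful for tensors
  with at least one slice.\<close>

definition dim1 :: "tensor \<Rightarrow> nat" where
  "dim1 A = dim_row (A ! 0)"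

definition dim2 :: "tensor \<Rightarrow> nat" where
  "dim2 A = dim_col (A ! 0)"

definition dct_mat :: "nat \<Rightarrow> real mat" where
  "dct_mat n = mat n n (\<lambda>(j, k).
     sqrt ((if j = 0 then 1 else 2) / real n)
       * cos (real j * (2 * real k + 1) * pi / (2 * real n)))"

definition W_mat :: "nat \<Rightarrow> real mat" where
  "W_mat n = mat_diag n (\<lambda>i. dct_mat n $$ (i, 0))"

definition Z_mat :: "nat \<Rightarrow> real mat" where
  "Z_mat n = mat n n (\<lambda>(i, j). if j = i + 1 then 1 else 0)"

definition M_mat :: "nat \<Rightarrow> real mat" where
  "M_mat n = the (mat_inverse (W_mat n)) * dct_mat n * (1\<^sub>m n + Z_mat n)"

definition L :: "tensor \<Rightarrow> tensor" where
  "L A = map (\<lambda>k. mat (dim1 A) (dim2 A) (\<lambda>(i, j).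
      \<Sum>l<length A. complex_of_real (M_mat (length A) $$ (k, l)) * (A ! l) $$ (i, j)))
    [0..<length A]"

text \<open>The tensor \<open>T\<close> determined by prescribing the frontal slices of \<open>L T\<close>.\<close>

definition tensor_of_L :: "nat \<Rightarrow> nat \<Rightarrow> nat \<Rightarrow> (nat \<Rightarrow> complex mat) \<Rightarrow> tensor" where
  "tensor_of_L n1 n2 n3 F =
     (THE T. T \<in> carrier_tensor n1 n2 n3 \<and> (\<forall>i<n3. L T ! i = F i))"

definition c_prod :: "tensor \<Rightarrow> tensor \<Rightarrow> tensor" (infixl \<open>*\<^sub>c\<close> 70) where
  "A *\<^sub>c B = tensor_of_L (dim1 A) (dim2 B) (length A) (\<lambda>i. L A ! i * L B ! i)"

definition c_adjoint :: "tensor \<Rightarrow> tensor" (\<open>(_\<^sup>H)\<close> [1000] 999) where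
  "A\<^sup>H = tensor_of_L (dim2 A) (dim1 A) (length A) (\<lambda>i. mat_adjoint (L A ! i))"

definition c_identity :: "nat \<Rightarrow> nat \<Rightarrow> tensor" where
  "c_identity n n3 = tensor_of_L n n n3 (\<lambda>i. 1\<^sub>m n)"

definition c_unitary :: "nat \<Rightarrow> nat \<Rightarrow> tensor \<Rightarrow> bool" where
  "c_unitary n n3 Q \<longleftrightarrow> Q \<in> carrier_tensor n n n3
     \<and> Q\<^sup>H *\<^sub>c Q = c_identity n n3 \<and> Q *\<^sub>c Q\<^sup>H = c_identity n n3"

definition F_diagonal :: "tensor \<Rightarrow> bool" where
  "F_diagonal S \<longleftrightarrow> (\<forall>i<length S. diagonal_mat (S ! i))"

definition is_C_SVD :: "nat \<Rightarrow> nat \<Rightarrow> nat \<Rightarrow> tensor \<Rightarrow> tensor \<Rightarrow> tensor \<Rightarrow> tensor \<Rightarrow> bool" where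
  "is_C_SVD n1 n2 n3 A U S V \<longleftrightarrow>
     c_unitary n1 n3 U \<and> c_unitary n2 n3 V
     \<and> S \<in> carrier_tensor n1 n2 n3 \<and> F_diagonal S
     \<and> A = U *\<^sub>c S *\<^sub>c V\<^sup>H"

definition is_MP_inverse :: "tensor \<Rightarrow> tensor \<Rightarrow> bool" where
  "is_MP_inverse A X \<longleftrightarrow>
     X \<in> carrier_tensor (dim2 A) (dim1 A) (length A)
     \<and> A *\<^sub>c X *\<^sub>c A = A
     \<and> X *\<^sub>c A *\<^sub>c X = X
     \<and> (A *\<^sub>c X)\<^sup>H = A *\<^sub>c X
     \<and> (X *\<^sub>c A)\<^sup>H = X *\<^sub>c A"

definition MP_inverse :: "tensor \<Rightarrow> tensor" (\<open>(_\<^sup>\<dagger>)\<close> [1000] 999) where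
  "A\<^sup>\<dagger> = (THE X. is_MP_inverse A X)"

end

theory Submission
  imports Defs
begin

text \<open>Because \<open>M\<close> is invertible, the map \<open>L\<close> is a bijection on tensors of a given shape, and it turns
  the C-product, the conjugate transpose and the identity tensor into the ordinary operations on
  each frontal slice of the transform. So \<open>X\<close> is a Moore-Penrose inverse of \<open>A\<close> exactly when every
  slice of \<open>L X\<close> satisfies the four Penrose equations for the corresponding slice of \<open>L A\<close>
  (\<open>is_MP_inverse_iff_slices\<close>), and a claim about tensors becomes one about complex matrices.

  For matrices, a solution of the Penrose equations is unique (\<open>penrose_unique\<close>), and if \<open>X\<close> solves
  them for \<open>S\<close>, then \<open>V X U\<^sup>H\<close> solves them for \<open>U S V\<^sup>H\<close> whenever \<open>U\<close> and \<open>V\<close> are unitary,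
  since the inner unitary factors cancel in every product (\<open>penrose_unitary_transform\<close>). Applied in
  each slice with \<open>X\<close> the slice of \<open>L (S\<^sup>\<dagger>)\<close>, this gives the theorem.

  Two points remain. The tensor \<open>S\<^sup>\<dagger>\<close> is a definite description, so a solution for \<open>S\<close> must be shown to
  exist: \<open>L\<close> combines slices linearly and hence keeps an F-diagonal tensor F-diagonal, and a diagonal
  matrix is solved by inverting its nonzero entries (\<open>penrose_diagonal_ex\<close>). And \<open>M\<close> must be shown to
  be invertible (\<open>M_mat_invertible\<close>): the cosine matrix is orthogonal, its first column has no zero
  entry, and \<open>I + Z\<close> is unit upper triangular.\<close>

section \<open>The cosine matrix is orthogonal\<close>

text \<open>The factor \<open>2 sin t\<close> makes the sum telescope:
  \<open>2 sin t cos x = sin (x + t) - sin (x - t)\<close>.\<close>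

lemma sum_cos_odd_multiples:
  fixes t :: real
  shows "2 * sin t * (\<Sum>k<n. cos ((2 * real k + 1) * t)) = sin (2 * real n * t)"
proof (induction n)
  case (Suc n)
  have "2 * sin t * cos ((2 * real n + 1) * t) = sin (2 * real (Suc n) * t) - sin (2 * real n * t)"
  proof -
    have "sin (2 * real (Suc n) * t) = sin ((2 * real n + 1) * t + t)"
      and "sin (2 * real n * t) = sin ((2 * real n + 1) * t - t)"
      by (simp_all add: algebra_simps)
    then show ?thesis by (simp add: sin_add sin_diff)
  qed
  with Suc show ?case by (simp add: distrib_left)
qed simp

text \<open>With \<open>t = m \<pi> / (2 n)\<close> the telescoped value is \<open>sin (m \<pi>) = 0\<close>, while the range of \<open>m\<close> puts
  \<open>t\<close> strictly between \<open>0\<close> and \<open>\<pi>\<close>, where the factor \<open>sin t\<close> can be cancelled.\<close>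

lemma sum_dct_cos_eq_0:
  assumes "0 < m" and "m < 2 * n"
  shows "(\<Sum>k<n. cos (real m * (2 * real k + 1) * pi / (2 * real n))) = 0"
proof -
  define t where "t = real m * pi / (2 * real n)"
  from assms have n: "0 < n" by auto
  have "0 < t" using assms n by (simp add: t_def)
  moreover have "t < pi"
  proof -
    have "real m * pi < (2 * real n) * pi"
      using assms by (intro mult_strict_right_mono) auto
    then show ?thesis using n by (simp add: t_def divide_less_eq mult.commute)
  qed
  ultimately have "sin t \<noteq> 0" using sin_gt_zero by force
  moreover have "sin (2 * real n * t) = 0"
    using n by (simp add: t_def)
  ultimately have "(\<Sum>k<n. cos ((2 * real k + 1) * t)) = 0"
    using sum_cos_odd_multiples[of t n] by simp
  then show ?thesis by (simp add: t_def ac_simps)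
qed

text \<open>The product formula for cosines reduces an inner product of two rows to the sums above with
  \<open>m = j - i\<close> and \<open>m = j + i\<close>. Both lie strictly between \<open>0\<close> and \<open>2 n\<close>.\<close>

lemma sum_dct_cos_mult_less:
  assumes "i < j" and "j < n"
  shows "(\<Sum>k<n. cos (real i * (2 * real k + 1) * pi / (2 * real n))
                * cos (real j * (2 * real k + 1) * pi / (2 * real n))) = 0"
proof -
  let ?c = "\<lambda>m k. cos (real m * (2 * real k + 1) * pi / (2 * real n))"
  have "?c i k * ?c j k = (?c (j - i) k + ?c (j + i) k) / 2" for k
  proof -
    have "?c (j - i) k = cos (real j * (2 * real k + 1) * pi / (2 * real n)
        - real i * (2 * real k + 1) * pi / (2 * real n))"
      using assms by (simp add: of_nat_diff left_diff_distrib diff_divide_distrib)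
    moreover have "?c (j + i) k = cos (real j * (2 * real k + 1) * pi / (2 * real n)
        + real i * (2 * real k + 1) * pi / (2 * real n))"
      by (simp add: distrib_right add_divide_distrib)
    ultimately show ?thesis by (simp add: cos_add cos_diff)
  qed
  then have "(\<Sum>k<n. ?c i k * ?c j k) = ((\<Sum>k<n. ?c (j - i) k) + (\<Sum>k<n. ?c (j + i) k)) / 2"
    by (simp only: sum.distrib flip: sum_divide_distrib)
  also have "\<dots> = 0"
    using assms by (simp add: sum_dct_cos_eq_0 del: of_nat_add of_nat_diff)
  finally show ?thesis .
qed

lemma sum_dct_cos_square:
  assumes "0 < i" and "i < n"
  shows "(\<Sum>k<n. (cos (real i * (2 * real k + 1) * pi / (2 * real n)))\<^sup>2) = real n / 2"
proof -
  have "(cos (real i * (2 * real k + 1) * pi / (2 * real n)))\<^sup>2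
      = (1 + cos (real (2 * i) * (2 * real k + 1) * pi / (2 * real n))) / 2" for k
    using cos_double_cos[of "real i * (2 * real k + 1) * pi / (2 * real n)"]
    by (simp add: mult.assoc)
  then have "(\<Sum>k<n. (cos (real i * (2 * real k + 1) * pi / (2 * real n)))\<^sup>2)
     = (\<Sum>k<n. (1 + cos (real (2 * i) * (2 * real k + 1) * pi / (2 * real n))) / 2)"
    by (rule sum.cong[OF refl])
  also have "\<dots> = (real n + (\<Sum>k<n. cos (real (2 * i) * (2 * real k + 1) * pi / (2 * real n)))) / 2"
    by (simp only: sum.distrib flip: sum_divide_distrib) simp
  also have "\<dots> = real n / 2"
    using assms by (subst sum_dct_cos_eq_0) simp_all
  finally show ?thesis .
qed

lemma dct_mat_orthogonal: "dct_mat n * (dct_mat n)\<^sup>T = 1\<^sub>m n"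
proof (rule eq_matI)
  fix i j assume "i < dim_row (1\<^sub>m n :: real mat)" and "j < dim_col (1\<^sub>m n :: real mat)"
  then have ij: "i < n" "j < n" by auto
  define w where "w i = sqrt ((if i = 0 then 1 else 2) / real n)" for i :: nat
  define c where "c i k = cos (real i * (2 * real k + 1) * pi / (2 * real n))" for i k :: nat
  have "(dct_mat n * (dct_mat n)\<^sup>T) $$ (i, j) = (\<Sum>k<n. (w i * c i k) * (w j * c j k))"
    using ij by (simp add: dct_mat_def scalar_prod_def w_def c_def lessThan_atLeast0)
  also have "\<dots> = w i * w j * (\<Sum>k<n. c i k * c j k)"
    by (simp add: sum_distrib_left ac_simps)
  also have "\<dots> = (if i = j then 1 else 0)"
  proof -
    consider "i < j" | "j < i" | "i = j" "i = 0" | "i = j" "0 < i" by linarith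
    then show ?thesis
    proof cases
      case 1
      then show ?thesis using sum_dct_cos_mult_less[of i j n] ij by (simp add: c_def)
    next
      case 2
      then show ?thesis using sum_dct_cos_mult_less[of j i n] ij by (simp add: c_def mult.commute)
    next
      case 3
      then show ?thesis using ij by (simp add: c_def w_def)
    next
      case 4
      then show ?thesis using sum_dct_cos_square[of i n] ij by (simp add: c_def w_def power2_eq_square)
    qed
  qed
  finally show "(dct_mat n * (dct_mat n)\<^sup>T) $$ (i, j) = 1\<^sub>m n $$ (i, j)"
    using ij by simp
qed (simp_all add: dct_mat_def)

section \<open>Invertibility of the transform matrix\<close>

lemma mat_inverse_if_det_nonzero:
  fixes A :: "'a :: field mat"
  assumes A: "A \<in> carrier_mat n n" and "det A \<noteq> 0"
  obtains B where "mat_inverse A = Some B" "A * B = 1\<^sub>m n" "B * A = 1\<^sub>m n" "B \<in> carrier_mat n n"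
proof -
  have "A \<in> Units (ring_mat TYPE('a) n ())"
    using assms by (rule det_non_zero_imp_unit)
  then obtain B where "mat_inverse A = Some B"
    using mat_inverse(1)[OF A, of "()"] by (cases "mat_inverse A") auto
  with mat_inverse(2)[OF A this] that show ?thesis by auto
qed

lemma det_nonzero_if_right_inverse:
  fixes A :: "'a :: field mat"
  assumes "A \<in> carrier_mat n n" "B \<in> carrier_mat n n" "A * B = 1\<^sub>m n"
  shows "det A \<noteq> 0"
  using det_mult[OF assms(1,2)] assms(3) by auto

text \<open>The entries of the first column are positive multiples of \<open>cos (i \<pi> / (2 n))\<close> with \<open>i < n\<close>, so
  the angle stays below \<open>\<pi> / 2\<close>.\<close>

lemma det_W_mat_nonzero: "det (W_mat n) \<noteq> 0"
proof (rule det_nonzero_if_right_inverse)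
  let ?f = "\<lambda>i. dct_mat n $$ (i, 0)"
  have pos: "?f i > 0" if "i < n" for i
  proof -
    have "0 \<le> real i * pi / (2 * real n)" and "real i * pi / (2 * real n) < pi / 2"
      using that by (simp_all add: field_simps)
    then have "cos (real i * pi / (2 * real n)) > 0"
      by (intro cos_gt_zero_pi) (use pi_gt_zero in linarith)+
    with that show ?thesis by (simp add: dct_mat_def)
  qed
  show "W_mat n * mat_diag n (\<lambda>i. inverse (?f i)) = 1\<^sub>m n"
    unfolding W_mat_def mat_diag_diag
    by (intro eq_matI) (auto simp: mat_diag_def less_imp_neq[OF pos, symmetric])
qed (simp_all add: W_mat_def)

lemma det_one_plus_Z_mat: "det (1\<^sub>m n + Z_mat n) = 1"
proof -
  have "det (1\<^sub>m n + Z_mat n) = prod_list (diag_mat (1\<^sub>m n + Z_mat n))"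
    by (rule det_upper_triangular[of _ n]) (auto simp: Z_mat_def)
  also have "diag_mat (1\<^sub>m n + Z_mat n) = replicate n 1"
    by (auto simp: diag_mat_def Z_mat_def intro!: nth_equalityI)
  finally show ?thesis by simp
qed

lemma M_mat_invertible:
  obtains N where "N \<in> carrier_mat n n" "M_mat n * N = 1\<^sub>m n" "N * M_mat n = 1\<^sub>m n"
    "M_mat n \<in> carrier_mat n n"
proof -
  have W: "W_mat n \<in> carrier_mat n n" by (simp add: W_mat_def)
  have C: "dct_mat n \<in> carrier_mat n n" by (simp add: dct_mat_def)
  have Z: "1\<^sub>m n + Z_mat n \<in> carrier_mat n n" by (simp add: Z_mat_def)
  obtain B where B: "mat_inverse (W_mat n) = Some B" "B * W_mat n = 1\<^sub>m n" "B \<in> carrier_mat n n"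
    using mat_inverse_if_det_nonzero[OF W det_W_mat_nonzero] by metis
  have "det B \<noteq> 0" using B W by (intro det_nonzero_if_right_inverse)
  moreover have "det (dct_mat n) \<noteq> 0"
    using C dct_mat_orthogonal by (intro det_nonzero_if_right_inverse[of _ n "(dct_mat n)\<^sup>T"]) auto
  ultimately have "det (M_mat n) \<noteq> 0"
    using B C Z by (simp add: M_mat_def det_mult[of _ n] det_one_plus_Z_mat)
  moreover have "M_mat n \<in> carrier_mat n n"
    using B C Z by (simp add: M_mat_def)
  ultimately show ?thesis
    using mat_inverse_if_det_nonzero[of "M_mat n" n] that by metis
qed

section \<open>Matrix products and adjoints\<close>

text \<open>Stated with dimensions, associativity is a rewrite rule whose side conditions the simplifier
  can discharge, which it cannot do for the inner dimensions in the carrier form.\<close>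

lemma assoc_mult_mat_dim:
  fixes A :: "'a :: semiring_0 mat"
  assumes "dim_col A = dim_row B" "dim_col B = dim_row C"
  shows "A * B * C = A * (B * C)"
  using assms by (intro assoc_mult_mat) auto

lemma mat_adjoint_dims [simp]:
  "dim_row (mat_adjoint A) = dim_col A" "dim_col (mat_adjoint A) = dim_row A"
  by (simp_all add: mat_adjoint_def)

lemma mat_adjoint_carrier:
  "A \<in> carrier_mat n m \<Longrightarrow> mat_adjoint A \<in> carrier_mat m n"
  by (intro carrier_matI) simp_all

lemma mat_adjoint_index:
  "i < dim_col A \<Longrightarrow> j < dim_row A \<Longrightarrow> mat_adjoint A $$ (i, j) = conjugate (A $$ (j, i))"
  by (simp add: mat_adjoint_def mat_of_rows_index)

lemma mat_adjoint_mult: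
  fixes A B :: "complex mat"
  assumes "A \<in> carrier_mat n m" "B \<in> carrier_mat m l"
  shows "mat_adjoint (A * B) = mat_adjoint B * mat_adjoint A"
  using assms by (intro eq_matI) (auto simp: mat_adjoint_index scalar_prod_def mult.commute intro!: sum.cong)

lemma mat_adjoint_mat_adjoint:
  fixes A :: "complex mat"
  shows "mat_adjoint (mat_adjoint A) = A"
  by (intro eq_matI) (auto simp: mat_adjoint_index)

section \<open>Tensors are determined by the slices of their transform\<close>

text \<open>The matrix is arbitrary so that \<open>L\<close> and its inverse are both of this form and composition becomes
  matrix multiplication. The shape is a parameter so that nothing depends on there being a first
  slice from which to read it off.\<close>

definition mode3_prod :: "real mat \<Rightarrow> nat \<Rightarrow> nat \<Rightarrow> nat \<Rightarrow> tensor \<Rightarrow> tensor" where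
  "mode3_prod K n1 n2 n3 T = map (\<lambda>k. mat n1 n2 (\<lambda>(i, j).
      \<Sum>l<n3. complex_of_real (K $$ (k, l)) * (T ! l) $$ (i, j))) [0..<n3]"

lemma mode3_prod_carrier: "mode3_prod K n1 n2 n3 T \<in> carrier_tensor n1 n2 n3"
  by (simp add: mode3_prod_def carrier_tensor_def)

lemma tensor_eqI:
  assumes "S \<in> carrier_tensor n1 n2 n3" "T \<in> carrier_tensor n1 n2 n3"
    and "\<And>i j k. i < n1 \<Longrightarrow> j < n2 \<Longrightarrow> k < n3 \<Longrightarrow> (S ! k) $$ (i, j) = (T ! k) $$ (i, j)"
  shows "S = T"
proof (rule nth_equalityI)
  show "length S = length T" using assms(1,2) by (simp add: carrier_tensor_def)
  fix k assume "k < length S"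
  then have "k < n3" "S ! k \<in> carrier_mat n1 n2" "T ! k \<in> carrier_mat n1 n2"
    using assms(1,2) by (simp_all add: carrier_tensor_def)
  then show "S ! k = T ! k"
    by (intro eq_matI) (simp_all only: carrier_matD assms(3))
qed

lemma mode3_prod_one:
  assumes "T \<in> carrier_tensor n1 n2 n3"
  shows "mode3_prod (1\<^sub>m n3) n1 n2 n3 T = T"
proof (rule tensor_eqI[OF mode3_prod_carrier assms])
  fix i j k assume "i < n1" "j < n2" "k < n3"
  then have "(mode3_prod (1\<^sub>m n3) n1 n2 n3 T ! k) $$ (i, j)
    = (\<Sum>l<n3. complex_of_real (1\<^sub>m n3 $$ (k, l)) * (T ! l) $$ (i, j))"
    by (simp add: mode3_prod_def)
  also have "\<dots> = (\<Sum>l<n3. if k = l then (T ! l) $$ (i, j) else 0)"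
    using \<open>k < n3\<close> by (intro sum.cong) auto
  also have "\<dots> = (T ! k) $$ (i, j)" using \<open>k < n3\<close> by simp
  finally show "(mode3_prod (1\<^sub>m n3) n1 n2 n3 T ! k) $$ (i, j) = (T ! k) $$ (i, j)" .
qed

lemma mode3_prod_mult:
  assumes "K \<in> carrier_mat n3 n3" "K' \<in> carrier_mat n3 n3"
  shows "mode3_prod K n1 n2 n3 (mode3_prod K' n1 n2 n3 T) = mode3_prod (K * K') n1 n2 n3 T"
proof (rule tensor_eqI[OF mode3_prod_carrier mode3_prod_carrier])
  fix i j k assume ijk: "i < n1" "j < n2" "k < n3"
  have "(mode3_prod K n1 n2 n3 (mode3_prod K' n1 n2 n3 T) ! k) $$ (i, j)
    = (\<Sum>l<n3. \<Sum>m<n3. complex_of_real (K $$ (k, l)) * (complex_of_real (K' $$ (l, m)) * (T ! m) $$ (i, j)))"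
    using ijk by (simp add: mode3_prod_def sum_distrib_left)
  also have "\<dots> = (\<Sum>m<n3. \<Sum>l<n3. complex_of_real (K $$ (k, l)) * (complex_of_real (K' $$ (l, m)) * (T ! m) $$ (i, j)))"
    by (rule sum.swap)
  also have "\<dots> = (mode3_prod (K * K') n1 n2 n3 T ! k) $$ (i, j)"
    using ijk assms
    by (simp add: mode3_prod_def scalar_prod_def sum_distrib_right lessThan_atLeast0 mult.assoc)
  finally show "(mode3_prod K n1 n2 n3 (mode3_prod K' n1 n2 n3 T) ! k) $$ (i, j)
    = (mode3_prod (K * K') n1 n2 n3 T ! k) $$ (i, j)" .
qed

lemma carrier_tensor_dims:
  assumes "T \<in> carrier_tensor n1 n2 n3" "0 < n3"
  shows "dim1 T = n1" "dim2 T = n2" "length T = n3"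
proof -
  have "T ! 0 \<in> carrier_mat n1 n2" using assms by (simp add: carrier_tensor_def)
  then show "dim1 T = n1" "dim2 T = n2" by (simp_all add: dim1_def dim2_def)
  show "length T = n3" using assms by (simp add: carrier_tensor_def)
qed

lemma L_eq_mode3_prod:
  assumes "T \<in> carrier_tensor n1 n2 n3" "0 < n3"
  shows "L T = mode3_prod (M_mat n3) n1 n2 n3 T"
  unfolding L_def mode3_prod_def carrier_tensor_dims[OF assms] by (rule refl)

lemma L_slice_carrier:
  assumes "T \<in> carrier_tensor n1 n2 n3" "i < n3"
  shows "L T ! i \<in> carrier_mat n1 n2"
proof -
  have "L T = mode3_prod (M_mat n3) n1 n2 n3 T"
    using assms by (intro L_eq_mode3_prod) simp_all
  then show ?thesis
    using mode3_prod_carrier[of "M_mat n3" n1 n2 n3 T] assms(2) by (simp add: carrier_tensor_def)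
qed

text \<open>The definite description is meaningful: multiplying the prescribed slices by \<open>M\<^sup>-\<^sup>1\<close> along the third
  mode gives a tensor with these slices, and it is the only one because \<open>M\<^sup>-\<^sup>1\<close> undoes \<open>L\<close>.\<close>

lemma tensor_of_L:
  assumes "0 < n3" and F: "\<And>i. i < n3 \<Longrightarrow> F i \<in> carrier_mat n1 n2"
  shows tensor_of_L_carrier: "tensor_of_L n1 n2 n3 F \<in> carrier_tensor n1 n2 n3"
    and L_tensor_of_L: "i < n3 \<Longrightarrow> L (tensor_of_L n1 n2 n3 F) ! i = F i"
    and tensor_of_L_eqI: "T \<in> carrier_tensor n1 n2 n3 \<Longrightarrow> (\<And>i. i < n3 \<Longrightarrow> L T ! i = F i)
      \<Longrightarrow> tensor_of_L n1 n2 n3 F = T"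
proof -
  let ?P = "\<lambda>T. T \<in> carrier_tensor n1 n2 n3 \<and> (\<forall>i<n3. L T ! i = F i)"
  obtain N where N: "N \<in> carrier_mat n3 n3" "M_mat n3 * N = 1\<^sub>m n3" "N * M_mat n3 = 1\<^sub>m n3"
    "M_mat n3 \<in> carrier_mat n3 n3"
    by (rule M_mat_invertible)
  let ?F = "map F [0..<n3]"
  let ?T = "mode3_prod N n1 n2 n3 ?F"
  have F': "?F \<in> carrier_tensor n1 n2 n3"
    using F by (simp add: carrier_tensor_def)
  have "L ?T = ?F"
    by (simp add: L_eq_mode3_prod[OF mode3_prod_carrier \<open>0 < n3\<close>] mode3_prod_mult N mode3_prod_one[OF F'])
  then have "?P ?T" by (simp add: mode3_prod_carrier)
  moreover have uniq: "T = ?T" if "?P T" for T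
  proof -
    have T: "T \<in> carrier_tensor n1 n2 n3" using that by simp
    have "L T = ?F"
      using that \<open>0 < n3\<close> carrier_tensor_dims(3)[OF T]
      by (intro nth_equalityI) (auto simp: L_def)
    then have "?T = mode3_prod N n1 n2 n3 (mode3_prod (M_mat n3) n1 n2 n3 T)"
      by (simp add: L_eq_mode3_prod[OF T \<open>0 < n3\<close>])
    also have "\<dots> = T"
      by (simp add: mode3_prod_mult N mode3_prod_one[OF T])
    finally show ?thesis by simp
  qed
  ultimately have eq: "tensor_of_L n1 n2 n3 F = ?T"
    unfolding tensor_of_L_def by (rule the_equality)
  with \<open>?P ?T\<close> show "tensor_of_L n1 n2 n3 F \<in> carrier_tensor n1 n2 n3"
    and "i < n3 \<Longrightarrow> L (tensor_of_L n1 n2 n3 F) ! i = F i" by auto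
  show "tensor_of_L n1 n2 n3 F = T"
    if "T \<in> carrier_tensor n1 n2 n3" "\<And>i. i < n3 \<Longrightarrow> L T ! i = F i"
    unfolding eq using uniq[of T] that by simp
qed

text \<open>Both tensors equal the one determined by the slices of \<open>L T\<close>.\<close>

lemma tensor_eq_iff_L_slices:
  assumes "S \<in> carrier_tensor n1 n2 n3" "T \<in> carrier_tensor n1 n2 n3" "0 < n3"
  shows "S = T \<longleftrightarrow> (\<forall>i<n3. L S ! i = L T ! i)"
proof
  assume "\<forall>i<n3. L S ! i = L T ! i"
  then show "S = T"
    using tensor_of_L_eqI[OF \<open>0 < n3\<close> L_slice_carrier[OF assms(2)] assms(1)]
      tensor_of_L_eqI[OF \<open>0 < n3\<close> L_slice_carrier[OF assms(2)] assms(2)] by simp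
qed simp

lemma c_prod:
  assumes "S \<in> carrier_tensor n1 n2 n3" "T \<in> carrier_tensor n2 n4 n3" "0 < n3"
  shows c_prod_carrier: "S *\<^sub>c T \<in> carrier_tensor n1 n4 n3"
    and L_c_prod: "i < n3 \<Longrightarrow> L (S *\<^sub>c T) ! i = L S ! i * L T ! i"
proof -
  have F: "L S ! i * L T ! i \<in> carrier_mat n1 n4" if "i < n3" for i
    using that L_slice_carrier assms by (metis mult_carrier_mat)
  show "S *\<^sub>c T \<in> carrier_tensor n1 n4 n3"
    and "i < n3 \<Longrightarrow> L (S *\<^sub>c T) ! i = L S ! i * L T ! i"
    unfolding c_prod_def carrier_tensor_dims[OF assms(1,3)] carrier_tensor_dims[OF assms(2,3)]
    by (simp_all add: tensor_of_L_carrier L_tensor_of_L F \<open>0 < n3\<close>)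
qed

lemma c_adjoint:
  assumes "T \<in> carrier_tensor n1 n2 n3" "0 < n3"
  shows c_adjoint_carrier: "T\<^sup>H \<in> carrier_tensor n2 n1 n3"
    and L_c_adjoint: "i < n3 \<Longrightarrow> L (T\<^sup>H) ! i = mat_adjoint (L T ! i)"
  unfolding c_adjoint_def carrier_tensor_dims[OF assms]
  by (simp_all add: tensor_of_L_carrier L_tensor_of_L mat_adjoint_carrier L_slice_carrier[OF assms(1)] \<open>0 < n3\<close>)

lemma L_c_identity:
  assumes "0 < n3" and "i < n3"
  shows "L (c_identity n n3) ! i = 1\<^sub>m n"
  using assms by (simp add: c_identity_def L_tensor_of_L)

section \<open>Penrose equations for matrices\<close>

definition penrose :: "complex mat \<Rightarrow> complex mat \<Rightarrow> bool" where
  "penrose A X \<longleftrightarrow> A * X * A = A \<and> X * A * X = X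
     \<and> mat_adjoint (A * X) = A * X \<and> mat_adjoint (X * A) = X * A"

text \<open>For two solutions, \<open>A X\<close> and \<open>A Y\<close> are Hermitian projections onto the same column space, hence
  equal: \<open>A X = (A Y) (A X)\<close>, and taking adjoints reverses the factors, giving
  \<open>A X = (A X) (A Y) = A Y\<close>. Likewise \<open>X A = Y A\<close>, so \<open>X = X A X = Y A X = Y A Y = Y\<close>.\<close>

lemma penrose_unique:
  assumes A: "A \<in> carrier_mat n m" and X: "X \<in> carrier_mat m n" and Y: "Y \<in> carrier_mat m n"
    and AX: "penrose A X" and AY: "penrose A Y"
  shows "X = Y"
proof -
  note assoc = assoc_mult_mat_dim carrier_matD[OF A] carrier_matD[OF X] carrier_matD[OF Y]
  have "A * X = (A * Y * A) * X" using AY by (simp add: penrose_def)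
  also have "\<dots> = (A * Y) * (A * X)" by (simp add: assoc)
  finally have "mat_adjoint (A * X) = mat_adjoint (A * X) * mat_adjoint (A * Y)"
    using mat_adjoint_mult[of "A * Y" n n "A * X" n] A X Y by auto
  then have "A * X = (A * X) * (A * Y)" using AX AY by (simp add: penrose_def)
  also have "\<dots> = (A * X * A) * Y" by (simp add: assoc)
  also have "\<dots> = A * Y" using AX by (simp add: penrose_def)
  finally have 1: "A * X = A * Y" .
  have "X * A = X * (A * Y * A)" using AY by (simp add: penrose_def)
  also have "\<dots> = (X * A) * (Y * A)" by (simp add: assoc)
  finally have "mat_adjoint (X * A) = mat_adjoint (Y * A) * mat_adjoint (X * A)"
    using mat_adjoint_mult[of "X * A" m m "Y * A" m] A X Y by auto
  then have "X * A = (Y * A) * (X * A)" using AX AY by (simp add: penrose_def)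
  also have "\<dots> = Y * (A * X * A)" by (simp add: assoc)
  also have "\<dots> = Y * A" using AX by (simp add: penrose_def)
  finally have 2: "X * A = Y * A" .
  have "X = X * A * X" using AX by (simp add: penrose_def)
  also have "\<dots> = Y * (A * X)" unfolding 2 by (simp add: assoc)
  also have "\<dots> = Y * A * Y" unfolding 1 by (simp add: assoc)
  also have "\<dots> = Y" using AY by (simp add: penrose_def)
  finally show ?thesis .
qed

definition rect_diag :: "nat \<Rightarrow> nat \<Rightarrow> (nat \<Rightarrow> complex) \<Rightarrow> complex mat" where
  "rect_diag n m f = mat n m (\<lambda>(i, j). if i = j then f i else 0)"

lemma rect_diag_mult:
  "rect_diag n m f * rect_diag m l g = rect_diag n l (\<lambda>i. if i < m then f i * g i else 0)"
proof (rule eq_matI)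
  fix i j assume "i < dim_row (rect_diag n l (\<lambda>i. if i < m then f i * g i else 0))"
    and "j < dim_col (rect_diag n l (\<lambda>i. if i < m then f i * g i else 0))"
  then have ij: "i < n" "j < l" by (auto simp: rect_diag_def)
  have "(rect_diag n m f * rect_diag m l g) $$ (i, j)
    = (\<Sum>k<m. (if i = k then f i else 0) * (if k = j then g k else 0))"
    using ij by (simp add: rect_diag_def scalar_prod_def lessThan_atLeast0)
  also have "\<dots> = (\<Sum>k<m. if i = k then f i * (if k = j then g k else 0) else 0)"
    by (intro sum.cong) auto
  also have "\<dots> = (if i < m then f i * (if i = j then g i else 0) else 0)" by simp
  finally show "(rect_diag n m f * rect_diag m l g) $$ (i, j)
      = rect_diag n l (\<lambda>i. if i < m then f i * g i else 0) $$ (i, j)"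
    using ij by (auto simp: rect_diag_def)
qed (auto simp: rect_diag_def)

lemma mat_adjoint_rect_diag: "mat_adjoint (rect_diag n m f) = rect_diag m n (\<lambda>i. cnj (f i))"
  by (intro eq_matI) (auto simp: mat_adjoint_index rect_diag_def)

text \<open>The solution inverts the nonzero diagonal entries and keeps the zero ones. The convention
  \<open>inverse 0 = 0\<close> covers both cases by one formula.\<close>

lemma penrose_diagonal_ex:
  assumes "D \<in> carrier_mat n m" and "diagonal_mat D"
  shows "\<exists>X \<in> carrier_mat m n. penrose D X"
proof
  define f where "f i = D $$ (i, i)" for i
  have D: "D = rect_diag n m f"
    using assms by (intro eq_matI) (auto simp: rect_diag_def f_def diagonal_mat_def)
  have "f i * inverse (f i) = (if f i = 0 then 0 else 1)" for i by simp
  then show "penrose D (rect_diag m n (\<lambda>i. inverse (f i)))"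
    unfolding D penrose_def rect_diag_mult mat_adjoint_rect_diag
    by (auto simp: rect_diag_def mult.commute[of "inverse _"])
qed (simp add: rect_diag_def)

lemma mult_unitary_cancel:
  fixes P :: "complex mat"
  assumes c: "P \<in> carrier_mat p p" "A \<in> carrier_mat p q" "Q \<in> carrier_mat q q"
    "B \<in> carrier_mat q r" "R \<in> carrier_mat r r"
    and Q: "mat_adjoint Q * Q = 1\<^sub>m q"
  shows "(P * A * mat_adjoint Q) * (Q * B * mat_adjoint R) = P * (A * B) * mat_adjoint R"
proof -
  note dims = carrier_matD[OF c(1)] carrier_matD[OF c(2)] carrier_matD[OF c(3)]
    carrier_matD[OF c(4)] carrier_matD[OF c(5)]
  have "(P * A * mat_adjoint Q) * (Q * B * mat_adjoint R)
      = P * A * ((mat_adjoint Q * Q) * (B * mat_adjoint R))"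
    by (simp add: assoc_mult_mat_dim dims)
  also have "\<dots> = P * A * (B * mat_adjoint R)"
    by (simp add: Q dims)
  also have "\<dots> = P * (A * B) * mat_adjoint R"
    by (simp add: assoc_mult_mat_dim dims)
  finally show ?thesis .
qed

lemma mat_adjoint_sandwich:
  fixes P :: "complex mat"
  assumes "P \<in> carrier_mat p p" "A \<in> carrier_mat p q" "Q \<in> carrier_mat q q"
  shows "mat_adjoint (P * A * mat_adjoint Q) = Q * mat_adjoint A * mat_adjoint P"
proof -
  have "mat_adjoint (P * A * mat_adjoint Q) = Q * (mat_adjoint A * mat_adjoint P)"
    using assms by (simp add: mat_adjoint_mult[of "P * A" p q _ q] mat_adjoint_mult[of P p p A q]
        mat_adjoint_mat_adjoint mat_adjoint_carrier)
  then show ?thesis using assms by (simp add: assoc_mult_mat_dim)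
qed

text \<open>The two inner unitary factors cancel in each of the four products, so every Penrose equation for
  the transformed pair is the one for \<open>S\<close> and \<open>X\<close> multiplied by unitary matrices from outside.\<close>

lemma penrose_unitary_transform:
  assumes c: "U \<in> carrier_mat n n" "V \<in> carrier_mat m m" "S \<in> carrier_mat n m" "X \<in> carrier_mat m n"
    and U: "mat_adjoint U * U = 1\<^sub>m n" and V: "mat_adjoint V * V = 1\<^sub>m m"
    and SX: "penrose S X"
  shows "penrose (U * S * mat_adjoint V) (V * X * mat_adjoint U)"
proof -
  have SXc: "S * X \<in> carrier_mat n n" and XSc: "X * S \<in> carrier_mat m m" using c by auto
  have 1: "(U * S * mat_adjoint V) * (V * X * mat_adjoint U) = U * (S * X) * mat_adjoint U"
    using c V by (intro mult_unitary_cancel)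
  have 2: "(V * X * mat_adjoint U) * (U * S * mat_adjoint V) = V * (X * S) * mat_adjoint V"
    using c U by (intro mult_unitary_cancel)
  have "(U * (S * X) * mat_adjoint U) * (U * S * mat_adjoint V) = U * (S * X * S) * mat_adjoint V"
    using c U SXc by (intro mult_unitary_cancel)
  moreover have "(V * (X * S) * mat_adjoint V) * (V * X * mat_adjoint U) = V * (X * S * X) * mat_adjoint U"
    using c V XSc by (intro mult_unitary_cancel)
  ultimately show ?thesis
    using SX unfolding penrose_def 1 2
    by (simp add: mat_adjoint_sandwich[OF c(1) SXc c(1)] mat_adjoint_sandwich[OF c(2) XSc c(2)])
qed

section \<open>From slices back to tensors\<close>

lemma is_MP_inverse_iff_slices:
  assumes A: "A \<in> carrier_tensor n1 n2 n3" and n3: "0 < n3"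
  shows "is_MP_inverse A X \<longleftrightarrow>
    X \<in> carrier_tensor n2 n1 n3 \<and> (\<forall>i<n3. penrose (L A ! i) (L X ! i))"
proof (cases "X \<in> carrier_tensor n2 n1 n3")
  case X: True
  note AX = c_prod_carrier[OF A X n3] and XA = c_prod_carrier[OF X A n3]
  note eqs = tensor_eq_iff_L_slices[OF c_prod_carrier[OF AX A n3] A n3]
    tensor_eq_iff_L_slices[OF c_prod_carrier[OF XA X n3] X n3]
    tensor_eq_iff_L_slices[OF c_adjoint_carrier[OF AX n3] AX n3]
    tensor_eq_iff_L_slices[OF c_adjoint_carrier[OF XA n3] XA n3]
  have "is_MP_inverse A X \<longleftrightarrow> A *\<^sub>c X *\<^sub>c A = A \<and> X *\<^sub>c A *\<^sub>c X = X
     \<and> (A *\<^sub>c X)\<^sup>H = A *\<^sub>c X \<and> (X *\<^sub>c A)\<^sup>H = X *\<^sub>c A"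
    using X by (simp add: is_MP_inverse_def carrier_tensor_dims[OF A n3])
  also have "\<dots> \<longleftrightarrow> (\<forall>i<n3. penrose (L A ! i) (L X ! i))"
    unfolding eqs
    by (auto simp: penrose_def L_c_prod[OF AX A n3] L_c_prod[OF XA X n3] L_c_prod[OF A X n3]
        L_c_prod[OF X A n3] L_c_adjoint[OF AX n3] L_c_adjoint[OF XA n3])
  finally show ?thesis using X by simp
qed (simp add: is_MP_inverse_def carrier_tensor_dims[OF A n3])

lemma MP_inverse_eqI:
  assumes A: "A \<in> carrier_tensor n1 n2 n3" and n3: "0 < n3" and X: "is_MP_inverse A X"
  shows "A\<^sup>\<dagger> = X"
  unfolding MP_inverse_def
proof (rule the_equality)
  fix Y assume Y: "is_MP_inverse A Y"
  have Xc: "X \<in> carrier_tensor n2 n1 n3" and Yc: "Y \<in> carrier_tensor n2 n1 n3"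
    using X Y by (simp_all add: is_MP_inverse_iff_slices[OF A n3])
  have "L Y ! i = L X ! i" if "i < n3" for i
    using L_slice_carrier[OF A that] L_slice_carrier[OF Yc that] L_slice_carrier[OF Xc that]
    by (rule penrose_unique) (use X Y that in \<open>simp_all add: is_MP_inverse_iff_slices[OF A n3]\<close>)
  then show "Y = X" by (simp add: tensor_eq_iff_L_slices[OF Yc Xc n3])
qed (fact X)

text \<open>This settles that the definite description \<open>S\<^sup>\<dagger>\<close> denotes: each slice of \<open>L S\<close> is a linear
  combination of the diagonal slices of \<open>S\<close>, so the slicewise solutions exist and assemble to a tensor.\<close>

lemma is_MP_inverse_F_diagonal:
  assumes S: "S \<in> carrier_tensor n1 n2 n3" and n3: "0 < n3" and "F_diagonal S"
  shows "is_MP_inverse S (S\<^sup>\<dagger>)"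
proof -
  have zero: "(S ! l) $$ (p, q) = 0" if "l < n3" "p < n1" "q < n2" "p \<noteq> q" for l p q
  proof -
    have "S ! l \<in> carrier_mat n1 n2" and "diagonal_mat (S ! l)"
      using S \<open>F_diagonal S\<close> \<open>l < n3\<close> by (simp_all add: carrier_tensor_def F_diagonal_def)
    then show ?thesis using that by (simp add: diagonal_mat_def)
  qed
  have "diagonal_mat (L S ! i)" if "i < n3" for i
    using that by (simp add: L_eq_mode3_prod[OF S n3] mode3_prod_def diagonal_mat_def zero)
  then have "\<exists>X \<in> carrier_mat n2 n1. penrose (L S ! i) X" if "i < n3" for i
    using that L_slice_carrier[OF S] by (blast intro: penrose_diagonal_ex)
  then obtain F where "\<And>i. i < n3 \<Longrightarrow> F i \<in> carrier_mat n2 n1"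
    and "\<And>i. i < n3 \<Longrightarrow> penrose (L S ! i) (F i)" by metis
  then have "is_MP_inverse S (tensor_of_L n2 n1 n3 F)"
    by (simp add: is_MP_inverse_iff_slices[OF S n3] tensor_of_L_carrier L_tensor_of_L n3)
  with MP_inverse_eqI[OF S n3] show ?thesis by metis
qed

lemma c_unitary_slice:
  assumes "c_unitary n n3 Q" "i < n3"
  shows "mat_adjoint (L Q ! i) * (L Q ! i) = 1\<^sub>m n"
proof -
  have Q: "Q \<in> carrier_tensor n n n3" and QQ: "Q\<^sup>H *\<^sub>c Q = c_identity n n3" and n3: "0 < n3"
    using assms by (auto simp: c_unitary_def)
  from arg_cong[OF QQ, of "\<lambda>T. L T ! i"] show ?thesis
    by (simp add: L_c_prod[OF c_adjoint_carrier[OF Q n3] Q n3 \<open>i < n3\<close>] L_c_adjoint[OF Q n3 \<open>i < n3\<close>]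
        L_c_identity[OF n3 \<open>i < n3\<close>])
qed

theorem theorem3p3:
  fixes n1 n2 n3 :: nat and A U S V :: tensor
  assumes "n1 > 0" and "n2 > 0" and "n3 > 0"
    and "A \<in> carrier_tensor n1 n2 n3"
    and "is_C_SVD n1 n2 n3 A U S V"
  shows "A\<^sup>\<dagger> = V *\<^sub>c S\<^sup>\<dagger> *\<^sub>c U\<^sup>H"
proof (rule MP_inverse_eqI[OF assms(4,3)])
  note n3 = \<open>n3 > 0\<close>
  from assms(5) have unit: "c_unitary n1 n3 U" "c_unitary n2 n3 V"
    and U: "U \<in> carrier_tensor n1 n1 n3" and V: "V \<in> carrier_tensor n2 n2 n3"
    and S: "S \<in> carrier_tensor n1 n2 n3" and "F_diagonal S" and A: "A = U *\<^sub>c S *\<^sub>c V\<^sup>H"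
    by (auto simp: is_C_SVD_def c_unitary_def)
  from is_MP_inverse_F_diagonal[OF S n3 \<open>F_diagonal S\<close>]
  have X: "S\<^sup>\<dagger> \<in> carrier_tensor n2 n1 n3" and SX: "\<And>i. i < n3 \<Longrightarrow> penrose (L S ! i) (L (S\<^sup>\<dagger>) ! i)"
    by (simp_all add: is_MP_inverse_iff_slices[OF S n3])
  note US = c_prod_carrier[OF U S n3] and VX = c_prod_carrier[OF V X n3]
    and UH = c_adjoint_carrier[OF U n3] and VH = c_adjoint_carrier[OF V n3]
  have "penrose (L A ! i) (L (V *\<^sub>c S\<^sup>\<dagger> *\<^sub>c U\<^sup>H) ! i)" if "i < n3" for i
    using penrose_unitary_transform[OF L_slice_carrier[OF U that] L_slice_carrier[OF V that]
        L_slice_carrier[OF S that] L_slice_carrier[OF X that]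
        c_unitary_slice[OF unit(1) that] c_unitary_slice[OF unit(2) that] SX[OF that]]
    by (simp add: A L_c_prod[OF US VH n3 that] L_c_prod[OF U S n3 that] L_c_prod[OF VX UH n3 that]
        L_c_prod[OF V X n3 that] L_c_adjoint[OF U n3 that] L_c_adjoint[OF V n3 that])
  then show "is_MP_inverse A (V *\<^sub>c S\<^sup>\<dagger> *\<^sub>c U\<^sup>H)"
    using c_prod_carrier[OF VX UH n3] by (simp add: is_MP_inverse_iff_slices[OF assms(4) n3])
qed

end
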